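(* Let $\omega\in(0,\pi)$ be of the form $\omega=2\pi\frac{d}{p}$ for some positive integers $d,p$, and let $q\in(\varphi,q(p)]$, where $\varphi=\frac{1+\sqrt5}{2}$. Then the asymptotic reachable workspace $$W_{\infty,q,\omega}=\left\{\lim_{n\to\infty}x_n(\mathbf u,\mathbf v)\;\middle|\;\mathbf u,\mathbf v\in\{0,1\}^\infty\right\}\subset\mathbb C$$ contains a neighborhood of the origin.
   Context: $(f_n)_{n\ge 0}$ is the Fibonacci sequence with $f_0=f_1=1$ and $f_{n+2}=f_{n+1}+f_n$. For binary sequences $\mathbf u=(u_j)_{j\ge0},\mathbf v=(v_j)_{j\ge0}\in\{0,1\}^\infty$ and $n\ge0$, $$x_n(\mathbf u,\mathbf v)=\sum_{k=0}^n u_k\frac{f_k}{q^k}e^{-i\omega\sum_{j=0}^k v_j}\in\mathbb C .$$ For $q>\varphi$ the limit $\lim_{n\to\infty}x_n(\mathbf u,\mathbf v)$ always exists. For a positive integer $p$, $q(p)$ denotes the greatest real solution $q$ of the equation $$\sum_{k=0}^\infty\frac{f_{pk}}{q^{pk}}=2 .$$ *)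

theory Defs
  imports "HOL-Analysis.Analysis" "HOL-Number_Theory.Fib"
begin

text \<open>The library's \<^const>\<open>fib\<close> starts with 0, 1; the sequence used here starts with 1, 1.\<close>

definition fseq :: "nat \<Rightarrow> nat" where
  "fseq n = fib (Suc n)"

lemma fseq_rec: "fseq 0 = 1" "fseq 1 = 1" "fseq (n + 2) = fseq (n + 1) + fseq n"
  by (simp_all add: fseq_def)

definition golden_ratio :: real where
  "golden_ratio = (1 + sqrt 5) / 2"

definition binary_seqs :: "(nat \<Rightarrow> nat) set" where
  "binary_seqs = {u. \<forall>j. u j \<in> {0, 1}}"

definition x_seq :: "real \<Rightarrow> real \<Rightarrow> (nat \<Rightarrow> nat) \<Rightarrow> (nat \<Rightarrow> nat) \<Rightarrow> nat \<Rightarrow> complex" where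
  "x_seq q \<omega> u v n =
     (\<Sum>k=0..n. of_nat (u k) * of_real (real (fseq k) / q ^ k)
        * exp (- \<i> * of_real \<omega> * of_nat (\<Sum>j=0..k. v j)))"

text \<open>For \<open>q > golden_ratio\<close> every sequence \<open>x_seq q \<omega> u v\<close> converges, so each pair of binary
  sequences contributes exactly one point.\<close>

definition W_inf :: "real \<Rightarrow> real \<Rightarrow> complex set" where
  "W_inf q \<omega> = {z. \<exists>u\<in>binary_seqs. \<exists>v\<in>binary_seqs. x_seq q \<omega> u v \<longlonglongrightarrow> z}"

text \<open>Using \<^const>\<open>sums\<close> rather than \<^const>\<open>suminf\<close> makes convergence of the series part of being
  a solution. For \<open>p > 0\<close> the greatest solution exists: the sum decreases continuously from
  infinity to 1 as \<open>q\<close> runs from \<open>golden_ratio\<close> to infinity.\<close>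

definition q_crit :: "nat \<Rightarrow> real" where
  "q_crit p = (GREATEST q. (\<lambda>k. real (fseq (p * k)) / q ^ (p * k)) sums 2)"

end

theory Submission
  imports Defs
begin

text \<open>Take \<open>v\<close> constantly 1, so that the \<open>k\<close>-th term of \<^const>\<open>x_seq\<close> points in the
  direction \<open>\<zeta> ^ Suc k\<close>, where \<open>\<zeta> = exp (- \<i> * \<omega>)\<close> satisfies \<open>\<zeta> ^ p = 1\<close>. The terms whose index
  lies in a fixed residue class modulo \<open>p\<close> all point in the same direction, so the reachable points
  include the Minkowski sum of the \<open>p\<close> sets of subsums
  \<open>{\<Sum>j. w j * f (p * j + r) / q ^ (p * j + r)}\<close>, each turned into its own direction.

  Each of these sets of subsums is a full interval \<open>{0..T}\<close>. By Kakeya's greedy argument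
  (\<open>subsums_fill_interval\<close>) this happens as soon as no term exceeds the sum of the terms after it.
  For \<open>r = 0\<close> and the initial term that condition says that the series defining \<^const>\<open>q_crit\<close>
  has sum at least 2, which is what \<open>q \<le> q_crit p\<close> provides; every other
  instance reduces to this one because the Fibonacci numbers are supermultiplicative,
  \<open>f (m + n) \<ge> f m * f n\<close> (\<open>residue_class_term_le_tail\<close>).

  Since \<open>0 < \<omega> < pi\<close>, neither \<open>\<zeta>\<close> nor \<open>\<zeta>\<^sup>2\<close> is 1, so the \<open>p\<close> directions cancel and
  \<open>z = (2 / p) * (\<Sum>r<p. Re (z * cnj (\<zeta> ^ Suc r)) * \<zeta> ^ Suc r)\<close>. Adding the same positive constant
  to all coefficients does not change the sum, and for small \<open>z\<close> moves them into the intervals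
  (\<open>small_complex_as_root_combination\<close>).

  That \<^const>\<open>q_crit\<close> really is a solution is part of the proof: Binet's formula turns
  the series into two geometric ones, and the equation becomes quadratic in \<open>q ^ p\<close>.\<close>

section \<open>Subsums of a slowly decreasing series\<close>

text \<open>The greedy choice: take the \<open>n\<close>-th term whenever it does not exceed what is still missing. If
  it is skipped, the missing amount is below the term, hence at most the next tail; so the
  missing amount always stays between 0 and the tail, and tends to 0.\<close>

lemma subsums_fill_interval:
  fixes a :: "nat \<Rightarrow> real"
  assumes sm: "summable a" and term_le_tail: "\<And>n. a n \<le> (\<Sum>i. a (i + Suc n))"
    and t: "0 \<le> t" "t \<le> suminf a"
  obtains u :: "nat \<Rightarrow> nat" where "\<And>n. u n \<in> {0, 1}" and "(\<lambda>n. real (u n) * a n) sums t"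
proof -
  define rest where "rest = rec_nat t (\<lambda>n x. if a n \<le> x then x - a n else x)"
  define u where "u = (\<lambda>n. if a n \<le> rest n then 1 else 0 :: nat)"
  define tail where "tail = (\<lambda>n. \<Sum>i. a (i + n))"
  have rest_0: "rest 0 = t" and rest_Suc: "rest (Suc n) = rest n - real (u n) * a n" for n
    by (simp_all add: rest_def u_def)
  have tail_Suc: "tail (Suc n) = tail n - a n" for n
    using suminf_split_head[of "\<lambda>i. a (i + n)"] sm
    by (simp add: tail_def summable_ignore_initial_segment)
  have bounds: "0 \<le> rest n \<and> rest n \<le> tail n" for n
  proof (induction n)
    case 0
    show ?case using t by (simp add: rest_0 tail_def)
  next
    case (Suc n)
    then show ?case
      using term_le_tail[of n] tail_Suc[of n] by (auto simp: rest_Suc u_def tail_def)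
  qed
  have "tail \<longlonglongrightarrow> 0"
    unfolding tail_def by (rule suminf_exist_split2[OF sm])
  then have "rest \<longlonglongrightarrow> 0"
    using bounds by (intro tendsto_sandwich[of "\<lambda>_. 0" rest sequentially tail]) auto
  then have "(\<lambda>n. t - rest n) \<longlonglongrightarrow> t - 0"
    by (intro tendsto_intros)
  moreover have "(\<Sum>i<n. real (u i) * a i) = t - rest n" for n
    by (induction n) (auto simp: rest_0 rest_Suc)
  ultimately have "(\<lambda>n. real (u n) * a n) sums t"
    by (simp add: sums_def)
  moreover have "u n \<in> {0, 1}" for n
    by (simp add: u_def)
  ultimately show ?thesis
    using that by blast
qed

section \<open>The Fibonacci series and its critical base\<close>

definition golden_conj :: real where
  "golden_conj = (1 - sqrt 5) / 2"

lemma golden_ratio_gt_1: "1 < golden_ratio"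
proof -
  have "1 < sqrt 5" by simp
  then show ?thesis by (simp add: golden_ratio_def)
qed

lemma abs_golden_conj_less: "\<bar>golden_conj\<bar> < golden_ratio"
proof -
  have "1 < sqrt 5" by simp
  then show ?thesis by (simp add: golden_ratio_def golden_conj_def)
qed

lemma fseq_binet: "real (fseq n) = (golden_ratio ^ Suc n - golden_conj ^ Suc n) / sqrt 5"
  unfolding fseq_def golden_ratio_def golden_conj_def by (rule fib_closed_form)

lemma fseq_pos: "0 < fseq n"
  by (simp add: fseq_def fib_neq_0_nat)

lemma fseq_supermultiplicative: "fseq m * fseq n \<le> fseq (m + n)"
  using fib_add[of m "Suc n"] fib_add[of n m] by (simp add: fseq_def fib_add add.commute)

lemma fseq_series_sums:
  assumes "0 < p" and "golden_ratio < q"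
  shows "(\<lambda>k. real (fseq (p * k)) / q ^ (p * k)) sums
    ((golden_ratio / (1 - golden_ratio ^ p / q ^ p) - golden_conj / (1 - golden_conj ^ p / q ^ p))
      / sqrt 5)"
proof -
  have q: "0 < q"
    using golden_ratio_gt_1 assms by linarith
  have geo: "(\<lambda>k. c * (c ^ p / q ^ p) ^ k) sums (c * (1 / (1 - c ^ p / q ^ p)))" if "\<bar>c\<bar> < q" for c
  proof (intro sums_mult geometric_sums)
    have "\<bar>c\<bar> ^ p < q ^ p"
      using that assms by (intro power_strict_mono) auto
    then show "norm (c ^ p / q ^ p) < 1"
      using q by (simp add: power_abs)
  qed
  have "(\<lambda>k. (golden_ratio * (golden_ratio ^ p / q ^ p) ^ k
      - golden_conj * (golden_conj ^ p / q ^ p) ^ k) / sqrt 5) sums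
    ((golden_ratio * (1 / (1 - golden_ratio ^ p / q ^ p))
      - golden_conj * (1 / (1 - golden_conj ^ p / q ^ p))) / sqrt 5)"
    using assms golden_ratio_gt_1 abs_golden_conj_less
    by (intro sums_divide sums_diff geo) auto
  then show ?thesis
    by (simp add: fseq_binet power_mult power_divide diff_divide_distrib
        mult.commute[of "sqrt 5"])
qed

lemma summable_fseq_series:
  assumes "golden_ratio < q"
  shows "summable (\<lambda>k. real (fseq k) / q ^ k)"
  using fseq_series_sums[of 1 q] assms by (auto dest: sums_summable)

text \<open>Writing \<open>A\<close>, \<open>B\<close> for the \<open>p\<close>-th powers of the golden ratio and its conjugate and \<open>X = q ^ p\<close>,
  the closed form equals 2 exactly when the quadratic \<open>H\<close> below vanishes. It is negative at \<open>A\<close> and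
  positive at \<open>4 * A\<close>.\<close>

lemma fseq_series_sums_2_exists:
  assumes p: "0 < p"
  obtains s where "golden_ratio < s" and "(\<lambda>k. real (fseq (p * k)) / s ^ (p * k)) sums 2"
proof -
  define r where "r = sqrt 5"
  define A where "A = golden_ratio ^ p"
  define B where "B = golden_conj ^ p"
  define H where "H = (\<lambda>X. 2 * r * ((X - A) * (X - B))
    - (golden_ratio * X * (X - B) - golden_conj * X * (X - A)))"
  have r: "r > 1"
    by (simp add: r_def)
  have A: "A > 0"
    using golden_ratio_gt_1 by (simp add: A_def)
  have "\<bar>golden_conj\<bar> ^ p < golden_ratio ^ p"
    using abs_golden_conj_less p by (intro power_strict_mono) auto
  then have BA: "B < A"
    by (simp add: A_def B_def flip: power_abs)
  have "H A = - (golden_ratio * A * (A - B))"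
    by (simp add: H_def)
  moreover have "golden_ratio * A * (A - B) > 0"
    using golden_ratio_gt_1 A BA by simp
  ultimately have HA: "H A < 0"
    by linarith
  have "H (4 * A) = (4 * r - 2) * A * (A - B) + 6 * r * A * A"
    by (simp add: H_def golden_ratio_def golden_conj_def flip: r_def) (simp add: field_simps)
  moreover have "(4 * r - 2) * A * (A - B) > 0" "6 * r * A * A > 0"
    using r A BA by simp_all
  ultimately have H4A: "H (4 * A) > 0"
    by linarith
  have "continuous_on {A..4 * A} H"
    unfolding H_def by (intro continuous_intros)
  then obtain X where X: "A \<le> X" "H X = 0"
    using IVT'[of H A 0 "4 * A"] HA H4A A by auto
  have XA: "A < X"
    using X HA by (cases "X = A") auto
  have "(golden_ratio / (1 - A / X) - golden_conj / (1 - B / X)) / r = 2"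
  proof -
    have nz: "X \<noteq> 0" "X - A \<noteq> 0" "X - B \<noteq> 0" "r \<noteq> 0"
      using XA A BA r by auto
    have "golden_ratio / (1 - A / X) = golden_ratio * X / (X - A)"
      "golden_conj / (1 - B / X) = golden_conj * X / (X - B)"
      using nz by (simp_all add: divide_simps)
    moreover have "golden_ratio * X / (X - A) - golden_conj * X / (X - B)
        = (golden_ratio * X * (X - B) - golden_conj * X * (X - A)) / ((X - A) * (X - B))"
      using nz by (simp add: diff_frac_eq)
    moreover have "golden_ratio * X * (X - B) - golden_conj * X * (X - A)
        = 2 * r * ((X - A) * (X - B))"
      using X(2) by (simp add: H_def)
    ultimately show ?thesis
      using nz by simp
  qed
  moreover define s where "s = root p X"
  have s: "s ^ p = X" "0 \<le> s"
    using p XA A by (simp_all add: s_def)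
  moreover have "golden_ratio < s"
    using power_less_imp_less_base[of golden_ratio p s] XA s by (simp add: A_def)
  ultimately show ?thesis
    using that[of s] fseq_series_sums[OF p, of s] by (simp add: A_def B_def r_def)
qed

lemma fseq_term_antimono:
  assumes "0 < q" and "q \<le> s"
  shows "real (fseq k) / s ^ k \<le> real (fseq k) / q ^ k"
  using assms by (intro divide_left_mono power_mono) auto

text \<open>On the positive reals the series decreases strictly in its base, because of the term with
  index 1, so a positive solution is automatically the greatest.\<close>

lemma q_crit_solves:
  assumes p: "0 < p"
  shows "golden_ratio < q_crit p"
    and "(\<lambda>k. real (fseq (p * k)) / q_crit p ^ (p * k)) sums 2"
proof -
  obtain s where s: "golden_ratio < s" "(\<lambda>k. real (fseq (p * k)) / s ^ (p * k)) sums 2"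
    using fseq_series_sums_2_exists[OF p] .
  have s0: "0 < s"
    using s golden_ratio_gt_1 by linarith
  have "q_crit p = s"
    unfolding q_crit_def
  proof (rule Greatest_equality)
    show "(\<lambda>k. real (fseq (p * k)) / s ^ (p * k)) sums 2"
      by fact
  next
    fix y
    assume y: "(\<lambda>k. real (fseq (p * k)) / y ^ (p * k)) sums 2"
    show "y \<le> s"
    proof (rule ccontr)
      assume "\<not> y \<le> s"
      then have less: "s < y"
        by simp
      let ?d = "\<lambda>k. real (fseq (p * k)) / s ^ (p * k) - real (fseq (p * k)) / y ^ (p * k)"
      have d: "?d sums 0"
        using sums_diff[OF s(2) y] by simp
      have "s ^ p < y ^ p"
        using less s0 p by (intro power_strict_mono) auto
      then have "0 < ?d 1"
        using s0 less fseq_pos[of p] by (simp add: divide_strict_left_mono)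
      moreover have "0 \<le> ?d k" for k
        using fseq_term_antimono[of s y "p * k"] s0 less by simp
      ultimately have "0 < suminf ?d"
        using d by (intro suminf_pos2[of ?d 1]) (auto dest: sums_summable)
      then show False
        using d by (simp add: sums_iff)
    qed
  qed
  then show "golden_ratio < q_crit p"
    and "(\<lambda>k. real (fseq (p * k)) / q_crit p ^ (p * k)) sums 2"
    using s by simp_all
qed

lemma fseq_series_ge_2:
  assumes "0 < p" and "golden_ratio < q" and "q \<le> q_crit p"
  shows "2 \<le> (\<Sum>k. real (fseq (p * k)) / q ^ (p * k))"
proof -
  have "0 < q"
    using assms golden_ratio_gt_1 by linarith
  then show ?thesis
    using sums_le[OF fseq_term_antimono q_crit_solves(2) summable_sums] assms
      fseq_series_sums[of p q] by (auto dest: sums_summable)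
qed

section \<open>Residue classes of indices\<close>

lemma summable_residue_class:
  assumes "0 < p" and "golden_ratio < q"
  shows "summable (\<lambda>j. real (fseq (p * j + r)) / q ^ (p * j + r))"
proof -
  have "inj (\<lambda>j. p * j + r)"
    using assms by (simp add: inj_def)
  moreover have "0 < q"
    using assms golden_ratio_gt_1 by linarith
  ultimately show ?thesis
    using summable_reindex[OF summable_fseq_series[OF assms(2)], of "\<lambda>j. p * j + r"]
    by (simp add: o_def)
qed

text \<open>By supermultiplicativity, the term \<open>i\<close> steps ahead is at least the current term times the
  \<open>i\<close>-th term of the series for \<open>r = 0\<close>, and the latter without its initial 1 still sums to
  at least 1.\<close>

lemma residue_class_term_le_tail:
  fixes p :: nat and q :: real
  defines "a \<equiv> \<lambda>k. real (fseq k) / q ^ k"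
  assumes "0 < p" and "golden_ratio < q" and "q \<le> q_crit p"
  shows "a (p * n + r) \<le> (\<Sum>i. a (p * (i + Suc n) + r))"
proof -
  have q: "0 < q"
    using assms golden_ratio_gt_1 by linarith
  have sm: "summable (\<lambda>j. a (p * j + r))" for r
    unfolding a_def using assms by (intro summable_residue_class)
  have sm0: "summable (\<lambda>j. a (p * j))"
    using sm[of 0] by simp
  have "1 \<le> (\<Sum>i. a (p * Suc i))"
    using suminf_split_head[OF sm0] fseq_series_ge_2[of p q] assms by (simp add: fseq_rec)
  then have "a (p * n + r) * 1 \<le> a (p * n + r) * (\<Sum>i. a (p * Suc i))"
    using q by (intro mult_left_mono) (simp_all add: a_def)
  also have "\<dots> = (\<Sum>i. a (p * n + r) * a (p * Suc i))"
    using sm0 by (intro suminf_mult[symmetric]) (simp only: summable_Suc_iff[of "\<lambda>i. a (p * i)"])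
  also have "\<dots> \<le> (\<Sum>i. a (p * (i + Suc n) + r))"
  proof (rule suminf_le)
    fix i
    have "real (fseq (p * n + r)) * real (fseq (p * Suc i)) \<le> real (fseq (p * (i + Suc n) + r))"
      using fseq_supermultiplicative[of "p * n + r" "p * Suc i"]
      by (simp add: algebra_simps flip: of_nat_mult)
    then show "a (p * n + r) * a (p * Suc i) \<le> a (p * (i + Suc n) + r)"
      using q by (simp add: a_def divide_right_mono algebra_simps flip: power_add)
  next
    show "summable (\<lambda>i. a (p * n + r) * a (p * Suc i))"
      using sm0 by (intro summable_mult) (simp only: summable_Suc_iff[of "\<lambda>i. a (p * i)"])
    show "summable (\<lambda>i. a (p * (i + Suc n) + r))"
      using summable_ignore_initial_segment[OF sm[of r], of "Suc n"] .
  qed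
  finally show ?thesis
    by simp
qed

text \<open>Grouping a convergent series into blocks of \<open>p\<close> consecutive terms keeps its sum, and each block
  contains exactly one index from every residue class.\<close>

lemma sums_by_residue_classes:
  fixes f :: "nat \<Rightarrow> 'a::real_normed_vector"
  assumes "summable f" and "0 < p" and "\<And>r. r < p \<Longrightarrow> (\<lambda>j. f (p * j + r)) sums S r"
  shows "f sums (\<Sum>r<p. S r)"
proof -
  have "(\<lambda>j. sum f {j * p..<j * p + p}) sums suminf f"
    using assms by (intro sums_group summable_sums)
  moreover have "sum f {j * p..<j * p + p} = (\<Sum>r<p. f (p * j + r))" for j
    using sum.shift_bounds_nat_ivl[of f 0 "j * p" p]
    by (simp add: atLeast0LessThan algebra_simps)
  moreover have "(\<lambda>j. \<Sum>r<p. f (p * j + r)) sums (\<Sum>r<p. S r)"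
    using assms by (intro sums_sum) auto
  ultimately have "suminf f = (\<Sum>r<p. S r)"
    using sums_unique2 by simp
  then show ?thesis
    using summable_sums[OF assms(1)] by simp
qed

section \<open>Positive combinations of roots of unity\<close>

lemma sum_root_of_unity_powers:
  fixes c :: complex
  assumes "c ^ p = 1" and "c \<noteq> 1"
  shows "(\<Sum>r<p. c ^ Suc r) = 0"
  using assms by (simp add: geometric_sum flip: sum_distrib_left)

text \<open>Since \<open>2 * Re (z * cnj w) * w = z + cnj z * w\<^sup>2\<close> for \<open>w\<close> on the unit circle, summing
  over the powers of \<open>\<zeta>\<close> leaves \<open>p * z\<close>, the second part being a vanishing sum of powers
  of \<open>\<zeta>\<^sup>2\<close>.\<close>

lemma small_complex_as_root_combination:
  fixes \<zeta> z :: complex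
  assumes p: "0 < p" and root: "\<zeta> ^ p = 1" "\<zeta> \<noteq> 1" "\<zeta>\<^sup>2 \<noteq> 1"
    and small: "2 * norm z \<le> real p * e"
  obtains t :: "nat \<Rightarrow> real" where "\<And>r. 0 \<le> t r" and "\<And>r. t r \<le> 2 * e"
    and "z = (\<Sum>r<p. of_real (t r) * \<zeta> ^ Suc r)"
proof -
  have "norm \<zeta> ^ p = 1"
    using root(1) by (metis norm_one norm_power)
  then have norm: "norm \<zeta> = 1"
    using power_eq_imp_eq_base[of "norm \<zeta>" p 1] p by simp
  define c where "c = (\<lambda>r. 2 / real p * Re (z * cnj (\<zeta> ^ Suc r)))"
  have c_bound: "\<bar>c r\<bar> \<le> e" for r
  proof -
    have "\<bar>Re (z * cnj (\<zeta> ^ Suc r))\<bar> \<le> norm z"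
      using abs_Re_le_cmod[of "z * cnj (\<zeta> ^ Suc r)"] norm by (simp add: norm_mult norm_power)
    then have "2 * \<bar>Re (z * cnj (\<zeta> ^ Suc r))\<bar> \<le> real p * e"
      using small by linarith
    moreover have "\<bar>2 / real p * x\<bar> = 2 * \<bar>x\<bar> / real p" for x
      by (simp add: abs_mult)
    ultimately show ?thesis
      using p by (simp only: c_def) (simp add: divide_le_eq mult.commute del: power_Suc)
  qed
  have c_term: "of_real (c r) * \<zeta> ^ Suc r = (z + cnj z * (\<zeta>\<^sup>2) ^ Suc r) / of_nat p" for r
  proof -
    define w where "w = \<zeta> ^ Suc r"
    have "norm w = 1"
      by (simp add: w_def norm norm_mult norm_power)
    then have w: "cnj w * w = 1"
      using complex_norm_square[of w] by (simp add: mult.commute)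
    have "of_real (2 * Re (z * cnj w)) = z * cnj w + cnj z * w"
      using complex_add_cnj[of "z * cnj w"] by simp
    then have "of_real (2 * Re (z * cnj w)) * w = z * (cnj w * w) + cnj z * w\<^sup>2"
      by (simp add: algebra_simps power2_eq_square)
    moreover have "w\<^sup>2 = (\<zeta>\<^sup>2) ^ Suc r"
      unfolding w_def by (simp only: power_mult[symmetric] mult.commute)
    moreover have "of_real (c r) = complex_of_real (2 * Re (z * cnj w)) / of_nat p"
      by (simp add: c_def w_def)
    ultimately show ?thesis
      by (simp only: w w_def[symmetric] times_divide_eq_left mult_1_right)
  qed
  have "(\<zeta>\<^sup>2) ^ p = 1"
    using root(1) by (metis power_commutes power_mult mult.commute power_one)
  then have "(\<Sum>r<p. (\<zeta>\<^sup>2) ^ Suc r) = 0" "(\<Sum>r<p. \<zeta> ^ Suc r) = 0"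
    using sum_root_of_unity_powers root by blast+
  moreover have "(\<Sum>r<p. of_real (c r) * \<zeta> ^ Suc r)
      = (of_nat p * z + cnj z * (\<Sum>r<p. (\<zeta>\<^sup>2) ^ Suc r)) / of_nat p"
    unfolding c_term by (simp add: sum.distrib flip: sum_divide_distrib sum_distrib_left)
  moreover have "(\<Sum>r<p. of_real (e + c r) * \<zeta> ^ Suc r)
      = of_real e * (\<Sum>r<p. \<zeta> ^ Suc r) + (\<Sum>r<p. of_real (c r) * \<zeta> ^ Suc r)"
    by (simp only: of_real_add distrib_right sum.distrib sum_distrib_left)
  ultimately have "z = (\<Sum>r<p. of_real (e + c r) * \<zeta> ^ Suc r)"
    using p by simp
  moreover have "0 \<le> e + c r" "e + c r \<le> 2 * e" for r
    using c_bound[of r] by linarith+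
  ultimately show ?thesis
    using that[of "\<lambda>r. e + c r"] by blast
qed

lemma exp_minus_angle_root_of_unity:
  assumes "0 < \<omega>" and "\<omega> < pi" and "0 < p" and "\<omega> = 2 * pi * (real d / real p)"
  defines "\<zeta> \<equiv> exp (- \<i> * complex_of_real \<omega>)"
  shows "\<zeta> ^ p = 1" and "\<zeta> \<noteq> 1" and "\<zeta>\<^sup>2 \<noteq> 1"
proof -
  have \<zeta>: "\<zeta> = cis (- \<omega>)"
    by (simp add: \<zeta>_def cis_conv_exp)
  have "real p * \<omega> = 2 * pi * real d"
    using assms by simp
  then have "\<zeta> ^ p = cis (- (2 * pi * real d))"
    by (simp add: \<zeta> Complex.DeMoivre)
  also have "\<dots> = 1"
    using cis_multiple_2pi[of "- real d"] by simp
  finally show "\<zeta> ^ p = 1" .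
  have "sin \<omega> > 0"
    using assms by (intro sin_gt_zero)
  then show "\<zeta> \<noteq> 1"
    by (auto simp: \<zeta> complex_eq_iff)
  have "Re (\<zeta>\<^sup>2) = 1 - 2 * (sin \<omega>)\<^sup>2"
    by (simp add: \<zeta> Complex.DeMoivre cos_double_sin)
  then have "Re (\<zeta>\<^sup>2) \<noteq> Re 1"
    using \<open>sin \<omega> > 0\<close> by simp
  then show "\<zeta>\<^sup>2 \<noteq> 1"
    by metis
qed

section \<open>The workspace around the origin\<close>

text \<open>With \<open>v\<close> constantly 1, the direction of the \<open>k\<close>-th term depends only on \<open>k mod p\<close>. Hence the
  digits of the residue classes can be chosen independently, each by Kakeya's argument, and
  interleaved into one sequence \<open>u\<close>.\<close>

lemma root_combination_in_W_inf:
  fixes \<omega> q :: real and p :: nat and t :: "nat \<Rightarrow> real"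
  defines "\<zeta> \<equiv> exp (- \<i> * complex_of_real \<omega>)"
  assumes p: "0 < p" and root: "\<zeta> ^ p = 1" and q: "golden_ratio < q" "q \<le> q_crit p"
    and t: "\<And>r. 0 \<le> t r"
      "\<And>r. r < p \<Longrightarrow> t r \<le> (\<Sum>j. real (fseq (p * j + r)) / q ^ (p * j + r))"
  shows "(\<Sum>r<p. of_real (t r) * \<zeta> ^ Suc r) \<in> W_inf q \<omega>"
proof -
  define a where "a = (\<lambda>k. real (fseq k) / q ^ k)"
  have q0: "0 < q"
    using q golden_ratio_gt_1 by linarith
  have a0: "0 \<le> a k" for k
    using q0 by (simp add: a_def)
  have "\<exists>w :: nat \<Rightarrow> nat. (\<forall>j. w j \<in> {0, 1}) \<and> (\<lambda>j. real (w j) * a (p * j + r)) sums t r"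
    if "r < p" for r
  proof -
    have "summable (\<lambda>j. a (p * j + r))"
      unfolding a_def using p q by (intro summable_residue_class)
    moreover have "a (p * n + r) \<le> (\<Sum>i. a (p * (i + Suc n) + r))" for n
      unfolding a_def using p q by (intro residue_class_term_le_tail)
    ultimately show ?thesis
      using subsums_fill_interval[of "\<lambda>j. a (p * j + r)" "t r"] t(1)[of r] t(2)[OF that]
      unfolding a_def by metis
  qed
  then obtain w :: "nat \<Rightarrow> nat \<Rightarrow> nat"
    where w01: "\<And>r j. r < p \<Longrightarrow> w r j \<in> {0, 1}"
      and w: "\<And>r. r < p \<Longrightarrow> (\<lambda>j. real (w r j) * a (p * j + r)) sums t r"
    by metis
  define u where "u = (\<lambda>k. w (k mod p) (k div p))"
  define v :: "nat \<Rightarrow> nat" where "v = (\<lambda>_. 1)"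
  define f where "f = (\<lambda>k. of_real (real (u k) * a k) * \<zeta> ^ Suc k)"
  have u01: "u k \<in> {0, 1}" for k
    using w01 p by (simp add: u_def)
  have f_sums: "f sums (\<Sum>r<p. of_real (t r) * \<zeta> ^ Suc r)"
  proof (rule sums_by_residue_classes[OF _ p])
    have "norm (f k) \<le> a k" for k
      using u01[of k] a0[of k] by (auto simp: f_def \<zeta>_def norm_mult norm_power)
    moreover have "summable a"
      unfolding a_def using q(1) by (rule summable_fseq_series)
    ultimately show "summable f"
      by (intro summable_comparison_test'[of a 0 f])
  next
    fix r
    assume r: "r < p"
    have "\<zeta> ^ Suc (p * j + r) = \<zeta> ^ Suc r" for j
      using root by (simp add: power_add power_mult)
    moreover have "u (p * j + r) = w r j" for j
      using r by (simp add: u_def)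
    ultimately show "(\<lambda>j. f (p * j + r)) sums (of_real (t r) * \<zeta> ^ Suc r)"
      unfolding f_def using w[OF r] by (simp only: sums_mult2 sums_of_real)
  qed
  have "(\<Sum>j=0..k. v j) = Suc k" for k
    by (simp add: v_def)
  then have "exp (- \<i> * complex_of_real \<omega> * of_nat (\<Sum>j=0..k. v j)) = \<zeta> ^ Suc k" for k
    by (simp only: \<zeta>_def exp_of_nat2_mult)
  then have "x_seq q \<omega> u v = (\<lambda>n. \<Sum>k=0..n. f k)"
    by (simp add: fun_eq_iff x_seq_def f_def a_def del: power_Suc)
  then have "x_seq q \<omega> u v \<longlonglongrightarrow> (\<Sum>r<p. of_real (t r) * \<zeta> ^ Suc r)"
    using f_sums by (simp add: sums_def')
  moreover have "u \<in> binary_seqs" "v \<in> binary_seqs"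
    using u01 by (auto simp: binary_seqs_def v_def)
  ultimately show ?thesis
    unfolding W_inf_def by blast
qed

theorem theorem8:
  fixes \<omega> q :: real and d p :: nat
  assumes "0 < \<omega>" and "\<omega> < pi"
    and "0 < d" and "0 < p" and "\<omega> = 2 * pi * (real d / real p)"
    and "golden_ratio < q" and "q \<le> q_crit p"
  shows "\<exists>U. open U \<and> 0 \<in> U \<and> U \<subseteq> W_inf q \<omega>"
proof -
  define \<zeta> where "\<zeta> = exp (- \<i> * complex_of_real \<omega>)"
  note root = exp_minus_angle_root_of_unity[OF assms(1,2,4,5), folded \<zeta>_def]
  define T where "T = (\<lambda>r. \<Sum>j. real (fseq (p * j + r)) / q ^ (p * j + r))"
  \<comment> \<open>The midpoint of the shortest of the intervals of subsums: around it, coefficients can move by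
    \<open>e\<close> in both directions without leaving any interval.\<close>
  define e where "e = Min (T ` {..<p}) / 2"
  have q: "0 < q"
    using assms golden_ratio_gt_1 by linarith
  have "0 < T r" for r
    unfolding T_def
    using assms(4,6) q by (intro suminf_pos summable_residue_class) (simp_all add: fseq_pos)
  moreover have "{..<p} \<noteq> {}"
    using assms(4) by auto
  ultimately have e: "0 < e"
    by (simp add: e_def)
  have T: "2 * e \<le> T r" if "r < p" for r
    using that by (simp add: e_def)
  have "z \<in> W_inf q \<omega>" if "z \<in> ball 0 (real p * e / 2)" for z
  proof -
    have "2 * norm z \<le> real p * e"
      using that by simp
    then obtain t where "\<And>r. 0 \<le> t r" "\<And>r. t r \<le> 2 * e"
      and z: "z = (\<Sum>r<p. of_real (t r) * \<zeta> ^ Suc r)"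
      using small_complex_as_root_combination[OF assms(4) root] by blast
    then show ?thesis
      using root_combination_in_W_inf[of p \<omega> q t] root(1) assms(4,6,7) T
      unfolding z \<zeta>_def T_def by (meson order_trans)
  qed
  moreover have "0 \<in> ball (0 :: complex) (real p * e / 2)"
    using e assms(4) by simp
  ultimately show ?thesis
    using open_ball by blast
qed

end
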